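(* Let $(G,w)$ be a connected weighted graph with $E(G)\neq\varnothing$ and with a pseudoultrametrizable weight $w$. The set $\mathfrak{U}_w$ of all pseudoultrametrics on $V(G)$ extending $w$ contains only one element if and only if $\mathrm{TM}\subseteq\mathrm{WCh}$.
   Context: A graph $G=(V(G),E(G))$ has a nonempty (possibly infinite) vertex set $V(G)$, and its edge set $E(G)$ (possibly empty) is a set of unordered pairs of distinct vertices. A path is a finite graph with at least one edge whose vertices can be enumerated without repetition as $v_1,\dots,v_n$ so that $\{v_i,v_j\}$ is an edge iff $|i-j|=1$; it connects $v_1$ and $v_n$. For distinct $u,v\in V(G)$, $\mathfrak{P}_{u,v}$ is the set of paths in $G$ (subgraphs of $G$, not necessarily induced) connecting $u$ and $v$. $G$ is connected if any two distinct vertices are connected by a path in $G$. A weighted graph $(G,w)$ is a graph $G$ with a function (weight) $w:E(G)\to\mathbb{R}^+=[0,+\infty)$. A pseudoultrametric on a set $X$ is a function $d:X\times X\to\mathbb{R}^+$ with $d(x,y)=d(y,x)$, $d(x,x)=0$ and $d(x,y)\le\max\{d(x,z),d(z,y)\}$ for all $x,y,z\in X$. A pseudoultrametric $d$ on $V(G)$ extends $w$ if $d(x,y)=w(\{x,y\})$ for every $\{x,y\}\in E(G)$. The weight $w$ is pseudoultrametrizable if some pseudoultrametric on $V(G)$ extends $w$. $\mathrm{TM}$ (twice-max) is the set of unordered pairs $\{p,q\}$ of distinct nonadjacent vertices of $G$ such that each path $P\in\mathfrak{P}_{p,q}$ contains at least two distinct edges $e_1,e_2$ with $w(e_1)=w(e_2)=\max_{e\in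 E(P)}w(e)$. $\mathrm{WCh}$ is the set of unordered pairs $\{u,v\}$ of distinct nonadjacent vertices of $G$ that are well chained, i.e. for every $\varepsilon>0$ there exists a path $u=u_1,u_2,\dots,u_n=v$ in $G$ such that $\{u_i,u_{i+1}\}\in E(G)$ and $w(\{u_i,u_{i+1}\})\le\varepsilon$ for $i=1,\dots,n-1$. *)

theory Defs
  imports Complex_Main "HOL-Library.FuncSet"
begin

record 'a ugraph =
  verts :: "'a set"
  edges :: "'a set set"

definition is_graph :: "'a ugraph \<Rightarrow> bool" where
  "is_graph G \<longleftrightarrow> verts G \<noteq> {} \<and>
     (\<forall>e\<in>edges G. \<exists>u\<in>verts G. \<exists>v\<in>verts G. u \<noteq> v \<and> e = {u, v})"

definition subgraph :: "'a ugraph \<Rightarrow> 'a ugraph \<Rightarrow> bool" where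
  "subgraph H G \<longleftrightarrow> is_graph H \<and> verts H \<subseteq> verts G \<and> edges H \<subseteq> edges G"

text \<open>A path is itself a graph; the list \<open>vs\<close> enumerates its vertices. The edge condition
  concerns the edges of \<open>P\<close>, not those of an ambient graph, so a path that is a subgraph of
  \<open>G\<close> need not be induced.\<close>

definition path_enum :: "'a ugraph \<Rightarrow> 'a list \<Rightarrow> bool" where
  "path_enum P vs \<longleftrightarrow> is_graph P \<and> edges P \<noteq> {} \<and> distinct vs \<and> set vs = verts P \<and>
     (\<forall>i<length vs. \<forall>j<length vs.
        {vs ! i, vs ! j} \<in> edges P \<longleftrightarrow> \<bar>int i - int j\<bar> = 1)"

definition path_connects :: "'a ugraph \<Rightarrow> 'a \<Rightarrow> 'a \<Rightarrow> bool" where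
  "path_connects P u v \<longleftrightarrow> (\<exists>vs. path_enum P vs \<and> hd vs = u \<and> last vs = v)"

definition paths_between :: "'a ugraph \<Rightarrow> 'a \<Rightarrow> 'a \<Rightarrow> 'a ugraph set" where
  "paths_between G u v = {P. subgraph P G \<and> path_connects P u v}"

definition connected_graph :: "'a ugraph \<Rightarrow> bool" where
  "connected_graph G \<longleftrightarrow>
     (\<forall>u\<in>verts G. \<forall>v\<in>verts G. u \<noteq> v \<longrightarrow> paths_between G u v \<noteq> {})"

definition weighted_graph :: "'a ugraph \<Rightarrow> ('a set \<Rightarrow> real) \<Rightarrow> bool" where
  "weighted_graph G w \<longleftrightarrow> is_graph G \<and> w \<in> edges G \<rightarrow> {0..}"

text \<open>Functions on \<open>X \<times> X\<close> are taken to be \<open>undefined\<close> outside \<open>X \<times> X\<close>, so that equality of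
  pseudoultrametrics on \<open>X\<close> is equality of HOL functions.\<close>

definition pseudoultrametric_on :: "'a set \<Rightarrow> ('a \<times> 'a \<Rightarrow> real) \<Rightarrow> bool" where
  "pseudoultrametric_on X d \<longleftrightarrow> d \<in> (X \<times> X) \<rightarrow>\<^sub>E {0..} \<and>
     (\<forall>x\<in>X. \<forall>y\<in>X. d (x, y) = d (y, x)) \<and>
     (\<forall>x\<in>X. d (x, x) = 0) \<and>
     (\<forall>x\<in>X. \<forall>y\<in>X. \<forall>z\<in>X. d (x, y) \<le> max (d (x, z)) (d (z, y)))"

definition extends_weight ::
    "'a ugraph \<Rightarrow> ('a set \<Rightarrow> real) \<Rightarrow> ('a \<times> 'a \<Rightarrow> real) \<Rightarrow> bool" where
  "extends_weight G w d \<longleftrightarrow>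
     (\<forall>x\<in>verts G. \<forall>y\<in>verts G. {x, y} \<in> edges G \<longrightarrow> d (x, y) = w {x, y})"

definition extending_pseudoultrametrics ::
    "'a ugraph \<Rightarrow> ('a set \<Rightarrow> real) \<Rightarrow> ('a \<times> 'a \<Rightarrow> real) set" where
  "extending_pseudoultrametrics G w =
     {d. pseudoultrametric_on (verts G) d \<and> extends_weight G w d}"

definition pseudoultrametrizable :: "'a ugraph \<Rightarrow> ('a set \<Rightarrow> real) \<Rightarrow> bool" where
  "pseudoultrametrizable G w \<longleftrightarrow>
     (\<exists>d. pseudoultrametric_on (verts G) d \<and> extends_weight G w d)"

definition TM :: "'a ugraph \<Rightarrow> ('a set \<Rightarrow> real) \<Rightarrow> 'a set set" where
  "TM G w = {{p, q} |p q. p \<in> verts G \<and> q \<in> verts G \<and> p \<noteq> q \<and> {p, q} \<notin> edges G \<and>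
     (\<forall>P\<in>paths_between G p q. \<exists>e1\<in>edges P. \<exists>e2\<in>edges P. e1 \<noteq> e2 \<and>
        w e1 = Max (w ` edges P) \<and> w e2 = Max (w ` edges P))}"

definition WCh :: "'a ugraph \<Rightarrow> ('a set \<Rightarrow> real) \<Rightarrow> 'a set set" where
  "WCh G w = {{u, v} |u v. u \<in> verts G \<and> v \<in> verts G \<and> u \<noteq> v \<and> {u, v} \<notin> edges G \<and>
     (\<forall>\<epsilon>>0. \<exists>P\<in>paths_between G u v. \<forall>e\<in>edges P. w e \<le> \<epsilon>)}"

end

theory Submission
  imports Defs
begin

text \<open>
  If the largest weight on a path from \<open>p\<close> to \<open>q\<close> is attained by exactly one edge, the strong
  triangle inequality forces every pseudoultrametric extending \<open>w\<close> to take that weight as the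
  distance of \<open>p\<close> and \<open>q\<close> (\<open>distance_eq_unique_max\<close>); if \<open>p\<close> and \<open>q\<close> are well chained, the
  distance is forced to be \<open>0\<close>. Two distinct nonadjacent vertices that do not form a pair in \<open>TM\<close>
  are joined by a path of the first kind. So when every pair in \<open>TM\<close> is well chained, all
  distances are determined by \<open>w\<close>.

  Conversely, let \<open>{p, q}\<close> be in \<open>TM\<close> but not in \<open>WCh\<close>. The infimum over all walks of the largest
  weight on the walk is the greatest extension of \<open>w\<close> (the bottleneck distance below), and it
  separates \<open>p\<close> from \<open>q\<close> because they are not well chained. Gluing \<open>p\<close> to \<open>q\<close> in this
  pseudoultrametric gives a pseudoultrametric in which \<open>p\<close> and \<open>q\<close> have distance \<open>0\<close>. It still
  extends \<open>w\<close> (\<open>weight_le_shortcut\<close>): if the shortcut through the glued point made an edge \<open>{x, y}\<close> shorter, there would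
  be chains of smaller edges from \<open>p\<close> to \<open>x\<close> and from \<open>y\<close> to \<open>q\<close>; these chains are disjoint, as
  otherwise \<open>x\<close> and \<open>y\<close> would already be too close, so together with \<open>{x, y}\<close> they form a path
  from \<open>p\<close> to \<open>q\<close> with only one heaviest edge, contradicting \<open>TM\<close>. Hence there are two different
  extensions.
\<close>

section \<open>Paths as lists of vertices\<close>

fun path_edges :: "'a list \<Rightarrow> 'a set set" where
  "path_edges (x # y # zs) = insert {x, y} (path_edges (y # zs))"
| "path_edges _ = {}"

lemma finite_path_edges [simp]: "finite (path_edges xs)"
  by (induction xs rule: path_edges.induct) auto

lemma path_edges_subset: "e \<in> path_edges xs \<Longrightarrow> e \<subseteq> set xs"
  by (induction xs rule: path_edges.induct) auto

lemma path_edges_iff_nth: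
  "e \<in> path_edges xs \<longleftrightarrow> (\<exists>i. Suc i < length xs \<and> e = {xs ! i, xs ! Suc i})"
proof (induction xs rule: path_edges.induct)
  case (1 x y zs)
  have "(\<exists>i. Suc i < length (x # y # zs) \<and> e = {(x # y # zs) ! i, (x # y # zs) ! Suc i}) \<longleftrightarrow>
      e = {x, y} \<or> (\<exists>i. Suc i < length (y # zs) \<and> e = {(y # zs) ! i, (y # zs) ! Suc i})"
    (is "(\<exists>i. ?P i) \<longleftrightarrow> _")
  proof -
    have "(\<exists>i. ?P i) \<longleftrightarrow> ?P 0 \<or> (\<exists>i. ?P (Suc i))"
      by (metis not0_implies_Suc)
    then show ?thesis
      by simp
  qed
  then show ?case using 1 by simp
qed auto

lemma path_edges_append:
  assumes "xs \<noteq> []" "ys \<noteq> []"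
  shows "path_edges (xs @ ys) = path_edges xs \<union> path_edges ys \<union> {{last xs, hd ys}}"
  using assms
proof (induction xs rule: path_edges.induct)
  case ("2_2" x)
  then show ?case by (cases ys) auto
qed auto

lemma path_edges_split:
  assumes "e \<in> path_edges zs"
  obtains xs ys where "zs = xs @ ys" "xs \<noteq> []" "ys \<noteq> []" "e = {last xs, hd ys}"
proof -
  obtain i where i: "Suc i < length zs" "e = {zs ! i, zs ! Suc i}"
    using assms by (auto simp: path_edges_iff_nth)
  have "last (take (Suc i) zs) = zs ! i" "hd (drop (Suc i) zs) = zs ! Suc i"
    using i by (simp_all add: take_Suc_conv_app_nth hd_drop_conv_nth)
  then show ?thesis
    using i by (intro that [of "take (Suc i) zs" "drop (Suc i) zs"]) auto
qed

lemma path_edges_nonempty: "2 \<le> length xs \<Longrightarrow> path_edges xs \<noteq> {}"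
  by (induction xs rule: path_edges.induct) auto

lemma is_graphD:
  assumes "is_graph G" "{x, y} \<in> edges G"
  shows "x \<in> verts G" "y \<in> verts G" "x \<noteq> y"
  using assms unfolding is_graph_def by (force simp: doubleton_eq_iff)+

lemma set_subset_verts:
  assumes "is_graph G" "path_edges xs \<subseteq> edges G" "hd xs \<in> verts G"
  shows "set xs \<subseteq> verts G"
  using assms(2,3)
  by (induction xs rule: path_edges.induct) (auto dest: is_graphD [OF assms(1)])

text \<open>The path graphs of the definition can be replaced by duplicate-free vertex lists, which are
  easier to split and to concatenate.\<close>

lemma paths_between_listD:
  assumes "P \<in> paths_between G u v"
  obtains xs where "distinct xs" "xs \<noteq> []" "hd xs = u" "last xs = v"
    "edges P = path_edges xs" "path_edges xs \<subseteq> edges G" "path_edges xs \<noteq> {}"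
proof -
  have sub: "edges P \<subseteq> edges G"
    using assms unfolding paths_between_def subgraph_def by simp
  obtain xs where enum: "path_enum P xs" and ends: "hd xs = u" "last xs = v"
    using assms unfolding paths_between_def path_connects_def by blast
  have gr: "is_graph P" and ne: "edges P \<noteq> {}"
    and dist: "distinct xs" and set: "set xs = verts P"
    and adj: "\<forall>i<length xs. \<forall>j<length xs.
      {xs ! i, xs ! j} \<in> edges P \<longleftrightarrow> \<bar>int i - int j\<bar> = 1"
    using enum unfolding path_enum_def by - (elim conjE, assumption)+
  have "e \<in> path_edges xs" if e: "e \<in> edges P" for e
  proof -
    obtain a b where "a \<in> set xs" "b \<in> set xs" "e = {a, b}"
      using gr e unfolding is_graph_def set by metis
    then obtain i j where ij: "i < length xs" "j < length xs" "e = {xs ! i, xs ! j}"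
      by (metis in_set_conv_nth)
    then have "\<bar>int i - int j\<bar> = 1"
      using adj [rule_format, OF ij(1,2)] e by simp
    then have "j = Suc i \<or> i = Suc j"
      by linarith
    then show ?thesis
      using ij by (auto simp: path_edges_iff_nth)
  qed
  moreover have "e \<in> edges P" if e: "e \<in> path_edges xs" for e
  proof -
    obtain i where i: "Suc i < length xs" "e = {xs ! i, xs ! Suc i}"
      using e by (auto simp: path_edges_iff_nth)
    then show ?thesis
      using adj [rule_format, of i "Suc i"] by simp
  qed
  ultimately have "edges P = path_edges xs"
    by (intro equalityI subsetI)
  moreover have "xs \<noteq> []"
    using gr set unfolding is_graph_def by auto
  ultimately show ?thesis
    using dist ends sub ne by (intro that) auto
qed

lemma paths_between_listI:
  assumes "is_graph G" "distinct xs" "2 \<le> length xs" "path_edges xs \<subseteq> edges G"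
    "hd xs \<in> verts G"
  obtains P where "P \<in> paths_between G (hd xs) (last xs)" "edges P = path_edges xs"
proof -
  let ?P = "\<lparr>verts = set xs, edges = path_edges xs\<rparr>"
  have gr: "is_graph ?P"
    unfolding is_graph_def
  proof (intro conjI ballI)
    show "verts ?P \<noteq> {}"
      using assms(3) by auto
    fix e assume "e \<in> edges ?P"
    then obtain i where "Suc i < length xs" "e = {xs ! i, xs ! Suc i}"
      by (auto simp: path_edges_iff_nth)
    moreover have "xs ! i \<noteq> xs ! Suc i"
      using calculation assms(2) by (simp add: nth_eq_iff_index_eq)
    ultimately show "\<exists>u\<in>verts ?P. \<exists>v\<in>verts ?P. u \<noteq> v \<and> e = {u, v}"
      by (metis Suc_lessD nth_mem ugraph.select_convs(1))
  qed
  have "{xs ! i, xs ! j} \<in> path_edges xs \<longleftrightarrow> \<bar>int i - int j\<bar> = 1"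
    if ij: "i < length xs" "j < length xs" for i j
  proof
    assume "{xs ! i, xs ! j} \<in> path_edges xs"
    then obtain k where "Suc k < length xs" "{xs ! i, xs ! j} = {xs ! k, xs ! Suc k}"
      by (auto simp: path_edges_iff_nth)
    then have "i = k \<and> j = Suc k \<or> i = Suc k \<and> j = k"
      using ij assms(2) by (auto simp: doubleton_eq_iff nth_eq_iff_index_eq)
    then show "\<bar>int i - int j\<bar> = 1"
      by auto
  next
    assume "\<bar>int i - int j\<bar> = 1"
    then have "j = Suc i \<or> i = Suc j"
      by linarith
    then show "{xs ! i, xs ! j} \<in> path_edges xs"
      using ij by (auto simp: path_edges_iff_nth)
  qed
  then have "path_enum ?P xs"
    using gr assms(2) path_edges_nonempty [OF assms(3)] unfolding path_enum_def by simp
  then have "?P \<in> paths_between G (hd xs) (last xs)"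
    using gr assms set_subset_verts [of G xs]
    unfolding paths_between_def subgraph_def path_connects_def by auto
  then show ?thesis
    using that by simp
qed

section \<open>Distances forced by the weight\<close>

lemma extending_pseudoultrametricD:
  assumes "d \<in> extending_pseudoultrametrics G w" "x \<in> verts G" "y \<in> verts G"
  shows "0 \<le> d (x, y)" "d (x, x) = 0" "d (x, y) = d (y, x)"
    "z \<in> verts G \<Longrightarrow> d (x, z) \<le> max (d (x, y)) (d (y, z))"
    "{x, y} \<in> edges G \<Longrightarrow> d (x, y) = w {x, y}"
  using assms
  by (auto simp: extending_pseudoultrametrics_def pseudoultrametric_on_def extends_weight_def)

text \<open>The value \<open>0\<close> is included for the sake of one-vertex lists, which have no edges.\<close>

lemma distance_le_Max_path:
  assumes "is_graph G" "d \<in> extending_pseudoultrametrics G w"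
    and "xs \<noteq> []" "path_edges xs \<subseteq> edges G" "hd xs \<in> verts G"
  shows "d (hd xs, last xs) \<le> Max (insert 0 (w ` path_edges xs))"
  using assms(3-5)
proof (induction xs rule: path_edges.induct)
  case (1 x y zs)
  let ?M = "Max (insert 0 (w ` path_edges (x # y # zs)))"
  have xy: "x \<in> verts G" "y \<in> verts G" "{x, y} \<in> edges G"
    using 1 is_graphD [OF assms(1), of x y] by auto
  have z: "last (y # zs) \<in> verts G"
    using set_subset_verts [OF assms(1), of "y # zs"] 1 xy
    by (metis insert_subset last_in_set list.distinct(1) list.sel(1) path_edges.simps(1) subsetD)
  have "d (y, last (y # zs)) \<le> Max (insert 0 (w ` path_edges (y # zs)))"
    using 1 xy by simp
  also have "\<dots> \<le> ?M"
    by (intro Max_mono) auto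
  finally have "d (y, last (y # zs)) \<le> ?M" .
  moreover have "w {x, y} \<le> ?M"
    by (intro Max_ge) auto
  then have "d (x, y) \<le> ?M"
    using extending_pseudoultrametricD(5) [OF assms(2) xy] by metis
  ultimately have "max (d (x, y)) (d (y, last (y # zs))) \<le> ?M"
    by (intro max.boundedI)
  then have "d (x, last (y # zs)) \<le> ?M"
    using extending_pseudoultrametricD(4) [OF assms(2) xy(1,2) z] by (rule order_trans [rotated])
  then show ?case
    by (metis last_ConsR list.distinct(1) list.sel(1))
qed (use extending_pseudoultrametricD(2) [OF assms(2)] in auto)

lemma distance_le_if_path_weights_le:
  assumes "is_graph G" "d \<in> extending_pseudoultrametrics G w"
    and "xs \<noteq> []" "path_edges xs \<subseteq> edges G" "hd xs \<in> verts G"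
    and "0 \<le> t" "\<And>e. e \<in> path_edges xs \<Longrightarrow> w e \<le> t"
  shows "d (hd xs, last xs) \<le> t"
proof -
  have "Max (insert 0 (w ` path_edges xs)) \<le> t"
    using assms(6,7) by (subst Max_le_iff) auto
  with distance_le_Max_path [OF assms(1-5)] show ?thesis
    by (rule order_trans)
qed

lemma distance_less_if_path_weights_less:
  assumes "is_graph G" "d \<in> extending_pseudoultrametrics G w"
    and "xs \<noteq> []" "path_edges xs \<subseteq> edges G" "hd xs \<in> verts G"
    and "0 < t" "\<And>e. e \<in> path_edges xs \<Longrightarrow> w e < t"
  shows "d (hd xs, last xs) < t"
proof -
  have "Max (insert 0 (w ` path_edges xs)) < t"
    using assms(6,7) by (subst Max_less_iff) auto
  with distance_le_Max_path [OF assms(1-5)] show ?thesis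
    by (rule order_le_less_trans)
qed

text \<open>The distance is at most \<open>w e\<close>, the largest weight on the path. If it were smaller, then \<open>w e\<close>
  would be positive; removing \<open>e\<close> splits the path into two parts of smaller weights, whose end
  points are then at distance less than \<open>w e\<close> as well. Going along both parts and from \<open>hd xs\<close> to
  \<open>last xs\<close> would make the ends of \<open>e\<close> closer than \<open>w e\<close>.\<close>

lemma distance_eq_unique_max:
  assumes G: "is_graph G" and d: "d \<in> extending_pseudoultrametrics G w"
    and xs: "distinct xs" "path_edges xs \<subseteq> edges G" "hd xs \<in> verts G"
    and e: "e \<in> path_edges xs" "\<And>f. f \<in> path_edges xs \<Longrightarrow> f \<noteq> e \<Longrightarrow> w f < w e"
  shows "d (hd xs, last xs) = w e"
proof -
  obtain as bs where s: "xs = as @ bs" "as \<noteq> []" "bs \<noteq> []" "e = {last as, hd bs}"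
    using path_edges_split [OF e(1)] by blast
  have E: "path_edges xs = path_edges as \<union> path_edges bs \<union> {e}"
    using s path_edges_append by simp
  have V: "set xs \<subseteq> verts G"
    using set_subset_verts [OF G xs(2,3)] .
  have in_V: "hd as \<in> verts G" "last as \<in> verts G" "hd bs \<in> verts G" "last bs \<in> verts G"
    using V s by auto
  have "hd bs \<notin> set as" "last as \<notin> set bs"
    using xs(1) s by (auto simp: disjoint_iff)
  then have "e \<notin> path_edges as" "e \<notin> path_edges bs"
    using s(4) path_edges_subset by blast+
  then have lt: "w f < w e" if "f \<in> path_edges as \<union> path_edges bs" for f
    using e(2) E that by blast
  have we: "d (last as, hd bs) = w e" "0 \<le> w e"
    using extending_pseudoultrametricD(1,5) [OF d in_V(2,3)] s(4) e(1) xs(2) by auto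
  have "w f \<le> w e" if "f \<in> path_edges xs" for f
    using e(2) [OF that] by (cases "f = e") auto
  then have "d (hd xs, last xs) \<le> w e"
    using s we(2) by (intro distance_le_if_path_weights_le [OF G d _ xs(2,3)]) auto
  moreover have "\<not> d (hd xs, last xs) < w e"
  proof
    assume less: "d (hd xs, last xs) < w e"
    then have less': "d (hd as, last bs) < w e"
      using s by simp
    have "0 < w e"
      using less' extending_pseudoultrametricD(1) [OF d in_V(1,4)] by simp
    then have "d (hd as, last as) < w e" "d (hd bs, last bs) < w e"
      using lt xs(2) E in_V by (auto intro!: distance_less_if_path_weights_less [OF G d] s)
    then have "d (last as, hd bs) < w e"
      using less' extending_pseudoultrametricD(3) [OF d in_V(1,2)]
        extending_pseudoultrametricD(3) [OF d in_V(3,4)]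
        extending_pseudoultrametricD(4) [OF d in_V(2,1,3)]
        extending_pseudoultrametricD(4) [OF d in_V(1,4,3)] by linarith
    then show False
      using we by simp
  qed
  ultimately show ?thesis
    by simp
qed

lemma extension_unique_if_TM_subset_WCh:
  assumes G: "is_graph G" and "TM G w \<subseteq> WCh G w"
    and d: "d \<in> extending_pseudoultrametrics G w" and d': "d' \<in> extending_pseudoultrametrics G w"
  shows "d = d'"
proof -
  have "d (p, q) = d' (p, q)" if pq: "p \<in> verts G" "q \<in> verts G" for p q
  proof -
    consider "p = q" | "{p, q} \<in> edges G" | "{p, q} \<in> WCh G w"
      | "p \<noteq> q" "{p, q} \<notin> edges G" "{p, q} \<notin> TM G w"
      using assms(2) by blast
    then show ?thesis
    proof cases
      case 3
      have "c (p, q) = 0" if c: "c \<in> extending_pseudoultrametrics G w" for c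
      proof -
        obtain u v where uv: "{p, q} = {u, v}" "u \<in> verts G"
          and chain: "\<And>\<epsilon>. 0 < \<epsilon> \<Longrightarrow> \<exists>P\<in>paths_between G u v. \<forall>e\<in>edges P. w e \<le> \<epsilon>"
          using 3 unfolding WCh_def by blast
        have "c (u, v) \<le> \<epsilon>" if \<epsilon>: "0 < \<epsilon>" for \<epsilon>
        proof -
          obtain P where P: "P \<in> paths_between G u v" "\<forall>e\<in>edges P. w e \<le> \<epsilon>"
            using chain [OF \<epsilon>] by blast
          obtain xs where xs: "xs \<noteq> []" "hd xs = u" "last xs = v" "path_edges xs \<subseteq> edges G"
            "edges P = path_edges xs"
            using paths_between_listD [OF P(1)] by metis
          have "c (hd xs, last xs) \<le> \<epsilon>"
            using P(2) xs uv \<epsilon> by (intro distance_le_if_path_weights_le [OF G c]) auto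
          then show ?thesis
            using xs by simp
        qed
        then have "c (u, v) \<le> 0"
          by (meson dense_ge)
        moreover have "c (u, v) = c (p, q)"
          using uv(1) extending_pseudoultrametricD(3) [OF c pq] by (auto simp: doubleton_eq_iff)
        ultimately show ?thesis
          using extending_pseudoultrametricD(1) [OF c pq] by simp
      qed
      from this [OF d] this [OF d'] show ?thesis
        by simp
    next
      case 4
      have "\<not> (\<forall>P\<in>paths_between G p q. \<exists>e1\<in>edges P. \<exists>e2\<in>edges P. e1 \<noteq> e2 \<and>
          w e1 = Max (w ` edges P) \<and> w e2 = Max (w ` edges P))" (is "\<not> ?twice")
      proof
        assume ?twice
        then have "{p, q} \<in> TM G w"
          unfolding TM_def by (intro CollectI exI [of _ p] exI [of _ q] conjI refl pq 4)
        with 4 show False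
          by blast
      qed
      then obtain P where P: "P \<in> paths_between G p q"
        and uniq: "\<And>e f. e \<in> edges P \<Longrightarrow> f \<in> edges P \<Longrightarrow> e \<noteq> f \<Longrightarrow>
          w e = Max (w ` edges P) \<Longrightarrow> w f \<noteq> Max (w ` edges P)"
        by metis
      obtain xs where xs: "distinct xs" "hd xs = p" "last xs = q"
        "edges P = path_edges xs" "path_edges xs \<subseteq> edges G" "path_edges xs \<noteq> {}"
        using paths_between_listD [OF P] by metis
      have "Max (w ` path_edges xs) \<in> w ` path_edges xs"
        using xs(6) by (intro Max_in) auto
      then obtain e where e: "e \<in> path_edges xs" "w e = Max (w ` path_edges xs)"
        by auto
      have "w f < w e" if f: "f \<in> path_edges xs" "f \<noteq> e" for f
      proof -
        have "w f \<le> w e"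
          using f e by simp
        moreover have "w f \<noteq> w e"
          using uniq [of e f] f e xs(4) by metis
        ultimately show ?thesis
          by simp
      qed
      then have "c (p, q) = w e" if "c \<in> extending_pseudoultrametrics G w" for c
        using distance_eq_unique_max [OF G that xs(1,5) _ e(1)] xs pq by simp
      from this [OF d] this [OF d'] show ?thesis
        by simp
    qed (use d d' pq in \<open>simp_all add: extending_pseudoultrametricD\<close>)
  qed
  moreover have "d \<in> extensional (verts G \<times> verts G)" "d' \<in> extensional (verts G \<times> verts G)"
    using d d'
    by (auto simp: extending_pseudoultrametrics_def pseudoultrametric_on_def PiE_def)
  ultimately show ?thesis
    by (intro extensionalityI) auto
qed

section \<open>The bottleneck distance\<close>

definition light_edges :: "'a ugraph \<Rightarrow> ('a set \<Rightarrow> real) \<Rightarrow> real \<Rightarrow> 'a rel" where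
  "light_edges G w t = {(x, y). {x, y} \<in> edges G \<and> w {x, y} \<le> t}"

text \<open>This is the infimum over all walks from \<open>x\<close> to \<open>y\<close> of the largest weight on the walk, where the
  walk without edges counts as \<open>0\<close>. Using reachability instead of walks makes the strong triangle
  inequality an instance of transitivity.\<close>

definition bottleneck :: "'a ugraph \<Rightarrow> ('a set \<Rightarrow> real) \<Rightarrow> 'a \<Rightarrow> 'a \<Rightarrow> real" where
  "bottleneck G w x y = Inf {t. 0 \<le> t \<and> (x, y) \<in> (light_edges G w t)\<^sup>*}"

lemma light_edges_rtrancl_mono:
  "s \<le> t \<Longrightarrow> (x, y) \<in> (light_edges G w s)\<^sup>* \<Longrightarrow> (x, y) \<in> (light_edges G w t)\<^sup>*"
  by (erule rtrancl_mono [THEN subsetD, rotated]) (auto simp: light_edges_def)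

lemma light_edges_rtrancl_sym:
  "(x, y) \<in> (light_edges G w t)\<^sup>* \<longleftrightarrow> (y, x) \<in> (light_edges G w t)\<^sup>*"
proof -
  have "sym ((light_edges G w t)\<^sup>*)"
    by (intro sym_rtrancl) (auto simp: sym_def light_edges_def insert_commute)
  then show ?thesis
    by (meson symD)
qed

lemma light_edges_rtrancl_distinct_list:
  assumes "(x, y) \<in> (light_edges G w t)\<^sup>*"
  obtains xs where "distinct xs" "xs \<noteq> []" "hd xs = x" "last xs = y"
    "path_edges xs \<subseteq> edges G" "\<forall>e\<in>path_edges xs. w e \<le> t"
proof -
  have "\<exists>xs. distinct xs \<and> xs \<noteq> [] \<and> hd xs = x \<and> last xs = y \<and>
      path_edges xs \<subseteq> edges G \<and> (\<forall>e\<in>path_edges xs. w e \<le> t)"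
    using assms
  proof (induction rule: converse_rtrancl_induct)
    case base
    show ?case by (intro exI [of _ "[y]"]) simp
  next
    case (step x z)
    then obtain xs where xs: "distinct xs" "xs \<noteq> []" "hd xs = z" "last xs = y"
      "path_edges xs \<subseteq> edges G" "\<forall>e\<in>path_edges xs. w e \<le> t"
      by blast
    show ?case
    proof (cases "x \<in> set xs")
      case True
      then obtain as bs where s: "xs = as @ x # bs"
        by (meson split_list)
      then have "path_edges (x # bs) \<subseteq> path_edges xs"
        using path_edges_append [of as "x # bs"] by (cases "as = []") auto
      then show ?thesis
        using xs s by (intro exI [of _ "x # bs"]) auto
    next
      case False
      have "path_edges (x # xs) = insert {x, z} (path_edges xs)"
        using xs(2,3) by (cases xs) auto
      then show ?thesis
        using xs False step(1) by (intro exI [of _ "x # xs"]) (auto simp: light_edges_def)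
    qed
  qed
  then show ?thesis
    using that by blast
qed

lemma path_edges_light_edges:
  assumes "xs \<noteq> []" "path_edges xs \<subseteq> edges G" "\<forall>e\<in>path_edges xs. w e \<le> t"
  shows "\<forall>z\<in>set xs. (hd xs, z) \<in> (light_edges G w t)\<^sup>*"
  using assms
proof (induction xs rule: path_edges.induct)
  case (1 x y zs)
  then have "(x, y) \<in> light_edges G w t"
    by (auto simp: light_edges_def)
  then show ?case
    using 1 by (auto intro: converse_rtrancl_into_rtrancl)
qed auto

lemma light_edges_rtrancl_total:
  assumes "connected_graph G" "x \<in> verts G" "y \<in> verts G"
  shows "\<exists>t\<ge>0. (x, y) \<in> (light_edges G w t)\<^sup>*"
proof (cases "x = y")
  case False
  then obtain P where P: "P \<in> paths_between G x y"
    using assms unfolding connected_graph_def by blast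
  obtain xs where xs: "xs \<noteq> []" "hd xs = x" "last xs = y" "path_edges xs \<subseteq> edges G"
    using paths_between_listD [OF P] by metis
  have "\<forall>e\<in>path_edges xs. w e \<le> Max (insert 0 (w ` path_edges xs))"
    by (auto intro: Max_ge)
  then have "(x, y) \<in> (light_edges G w (Max (insert 0 (w ` path_edges xs))))\<^sup>*"
    using path_edges_light_edges [OF xs(1,4)] xs by (metis last_in_set)
  moreover have "0 \<le> Max (insert 0 (w ` path_edges xs))"
    by simp
  ultimately show ?thesis
    by blast
qed auto

lemma bottleneck_le:
  assumes "0 \<le> t" "(x, y) \<in> (light_edges G w t)\<^sup>*"
  shows "bottleneck G w x y \<le> t"
  unfolding bottleneck_def using assms by (intro cInf_lower bdd_belowI [of _ 0]) auto

lemma bottleneck_lessD: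
  assumes "connected_graph G" "x \<in> verts G" "y \<in> verts G" "bottleneck G w x y < c"
  obtains t where "0 \<le> t" "t < c" "(x, y) \<in> (light_edges G w t)\<^sup>*"
proof -
  have "{t. 0 \<le> t \<and> (x, y) \<in> (light_edges G w t)\<^sup>*} \<noteq> {}"
    using light_edges_rtrancl_total [OF assms(1-3)] by blast
  from cInf_lessD [OF this assms(4) [unfolded bottleneck_def]] show ?thesis
    using that by auto
qed

lemma bottleneck_ge:
  assumes "connected_graph G" "x \<in> verts G" "y \<in> verts G"
    and "\<And>t. 0 \<le> t \<Longrightarrow> (x, y) \<in> (light_edges G w t)\<^sup>* \<Longrightarrow> c \<le> t"
  shows "c \<le> bottleneck G w x y"
proof (rule ccontr)
  assume "\<not> ?thesis"
  then obtain t where "t < c" "0 \<le> t" "(x, y) \<in> (light_edges G w t)\<^sup>*"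
    using bottleneck_lessD [OF assms(1-3), of w c] by auto
  then show False
    using assms(4) [of t] by simp
qed

lemma bottleneck_refl [simp]:
  assumes "connected_graph G" "x \<in> verts G"
  shows "bottleneck G w x x = 0"
  by (intro antisym bottleneck_le bottleneck_ge assms) auto

lemma bottleneck_sym: "bottleneck G w x y = bottleneck G w y x"
  unfolding bottleneck_def using light_edges_rtrancl_sym [of x y] by simp

lemma bottleneck_ultra:
  assumes "connected_graph G" "x \<in> verts G" "y \<in> verts G" "z \<in> verts G"
  shows "bottleneck G w x z \<le> max (bottleneck G w x y) (bottleneck G w y z)"
proof (rule dense_ge)
  fix c assume c: "max (bottleneck G w x y) (bottleneck G w y z) < c"
  obtain s where s: "0 \<le> s" "s < c" "(x, y) \<in> (light_edges G w s)\<^sup>*"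
    using bottleneck_lessD [OF assms(1,2,3)] c by (metis max_less_iff_conj)
  obtain t where t: "0 \<le> t" "t < c" "(y, z) \<in> (light_edges G w t)\<^sup>*"
    using bottleneck_lessD [OF assms(1,3,4)] c by (metis max_less_iff_conj)
  have "(x, z) \<in> (light_edges G w c)\<^sup>*"
    using light_edges_rtrancl_mono [of s c] light_edges_rtrancl_mono [of t c] s t
    by (meson less_imp_le rtrancl_trans)
  then show "bottleneck G w x z \<le> c"
    using s by (intro bottleneck_le) auto
qed

text \<open>No walk between the ends of an edge can beat the edge itself, because some pseudoultrametric
  realizes the weight and is bounded by the largest weight on any walk.\<close>

lemma bottleneck_eq_weight:
  assumes G: "weighted_graph G w" and conn: "connected_graph G"
    and d: "d \<in> extending_pseudoultrametrics G w" and xy: "{x, y} \<in> edges G"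
  shows "bottleneck G w x y = w {x, y}"
proof (rule antisym)
  have gr: "is_graph G" and w: "0 \<le> w {x, y}"
    using G xy unfolding weighted_graph_def by auto
  have V: "x \<in> verts G" "y \<in> verts G"
    using is_graphD [OF gr xy] by auto
  show "bottleneck G w x y \<le> w {x, y}"
    using w xy by (intro bottleneck_le) (auto simp: light_edges_def)
  show "w {x, y} \<le> bottleneck G w x y"
  proof (rule bottleneck_ge [OF conn V])
    fix t assume t: "0 \<le> t" "(x, y) \<in> (light_edges G w t)\<^sup>*"
    obtain xs where xs: "xs \<noteq> []" "hd xs = x" "last xs = y" "path_edges xs \<subseteq> edges G"
      "\<forall>e\<in>path_edges xs. w e \<le> t"
      using light_edges_rtrancl_distinct_list [OF t(2)] by metis
    have "d (hd xs, last xs) \<le> t"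
      using xs V t by (intro distance_le_if_path_weights_le [OF gr d]) auto
    then show "w {x, y} \<le> t"
      using xs extending_pseudoultrametricD(5) [OF d V xy] by simp
  qed
qed

lemma bottleneck_pos_if_not_well_chained:
  assumes G: "is_graph G" and conn: "connected_graph G"
    and pq: "p \<in> verts G" "q \<in> verts G" "p \<noteq> q"
    and \<epsilon>: "0 < \<epsilon>" "\<And>P. P \<in> paths_between G p q \<Longrightarrow> \<exists>e\<in>edges P. \<epsilon> < w e"
  shows "0 < bottleneck G w p q"
proof -
  have "\<epsilon> \<le> bottleneck G w p q"
  proof (rule bottleneck_ge [OF conn pq(1,2)])
    fix t assume t: "(p, q) \<in> (light_edges G w t)\<^sup>*"
    obtain xs where xs: "distinct xs" "xs \<noteq> []" "hd xs = p" "last xs = q"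
      "path_edges xs \<subseteq> edges G" "\<forall>e\<in>path_edges xs. w e \<le> t"
      using light_edges_rtrancl_distinct_list [OF t] by metis
    have "2 \<le> length xs"
      using xs(2-4) pq(3) by (cases xs rule: path_edges.cases) auto
    then obtain P where "P \<in> paths_between G p q" "edges P = path_edges xs"
      using paths_between_listI [OF G xs(1) _ xs(5)] xs(3,4) pq(1) by metis
    then show "\<epsilon> \<le> t"
      using \<epsilon>(2) xs(6) by fastforce
  qed
  then show ?thesis
    using \<epsilon>(1) by simp
qed

section \<open>Gluing two points\<close>

text \<open>The quotient pseudoultrametric obtained by identifying \<open>p\<close> and \<open>q\<close>: the second and third terms
  account for passing through the identified point in either direction.\<close>

definition glue :: "('a \<Rightarrow> 'a \<Rightarrow> real) \<Rightarrow> 'a \<Rightarrow> 'a \<Rightarrow> 'a \<Rightarrow> 'a \<Rightarrow> real" where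
  "glue f p q x y = min (f x y) (min (max (f x p) (f q y)) (max (f x q) (f p y)))"

lemma glue_ultra:
  assumes sym: "\<And>x y. f x y = f y x"
    and ultra: "\<And>x y z. x \<in> X \<Longrightarrow> y \<in> X \<Longrightarrow> z \<in> X \<Longrightarrow> f x z \<le> max (f x y) (f y z)"
    and X: "p \<in> X" "q \<in> X" "x \<in> X" "y \<in> X" "z \<in> X"
  shows "glue f p q x z \<le> max (glue f p q x y) (glue f p q y z)"
proof -
  \<comment> \<open>Being at most \<open>c\<close> is transitive for \<open>f\<close>, which turns the nine combinations of routes into
    propositional reasoning.\<close>
  define c where "c = max (glue f p q x y) (glue f p q y z)"
  have trans: "f a e \<le> c" if "a \<in> X" "b \<in> X" "e \<in> X" "f a b \<le> c" "f b e \<le> c" for a b e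
    using ultra [OF that(1-3)] max.boundedI [OF that(4,5)] by (rule order_trans)
  note glue_le_iff = glue_def min_le_iff_disj max.bounded_iff
  have "glue f p q x y \<le> c" "glue f p q y z \<le> c"
    unfolding c_def by simp_all
  then have "f x y \<le> c \<or> f x p \<le> c \<and> f y q \<le> c \<or> f x q \<le> c \<and> f y p \<le> c"
    and "f y z \<le> c \<or> f y p \<le> c \<and> f q z \<le> c \<or> f y q \<le> c \<and> f p z \<le> c"
    unfolding glue_le_iff using sym by metis+
  then have "f x z \<le> c \<or> f x p \<le> c \<and> f q z \<le> c \<or> f x q \<le> c \<and> f p z \<le> c"
    using trans [OF X(3,4,5)] trans [OF X(3,1,5)] trans [OF X(3,2,5)] trans [OF X(3,4,1)]
      trans [OF X(3,4,2)] sym [of y p] sym [of y q] trans [OF X(1,4,5)] trans [OF X(2,4,5)]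
    by metis
  then have "glue f p q x z \<le> c"
    unfolding glue_le_iff .
  then show ?thesis
    by (simp only: c_def)
qed

text \<open>A shortcut through the glued point that is shorter than the edge \<open>{x, y}\<close> would produce a path
  from \<open>p\<close> to \<open>q\<close> on which \<open>{x, y}\<close> is the only heaviest edge.\<close>

lemma weight_le_shortcut:
  assumes G: "weighted_graph G w" and conn: "connected_graph G"
    and d: "d \<in> extending_pseudoultrametrics G w"
    and pq: "p \<in> verts G" "q \<in> verts G"
    and TM: "\<And>P. P \<in> paths_between G p q \<Longrightarrow> \<exists>e1\<in>edges P. \<exists>e2\<in>edges P. e1 \<noteq> e2 \<and>
        w e1 = Max (w ` edges P) \<and> w e2 = Max (w ` edges P)"
    and xy: "{x, y} \<in> edges G"
  shows "w {x, y} \<le> max (bottleneck G w p x) (bottleneck G w y q)"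
proof (rule ccontr)
  assume "\<not> ?thesis"
  then have less: "bottleneck G w p x < w {x, y}" "bottleneck G w y q < w {x, y}"
    by auto
  have gr: "is_graph G"
    using G unfolding weighted_graph_def by simp
  have V: "x \<in> verts G" "y \<in> verts G"
    using is_graphD [OF gr xy] by auto
  obtain s where s: "0 \<le> s" "s < w {x, y}" "(p, x) \<in> (light_edges G w s)\<^sup>*"
    using bottleneck_lessD [OF conn pq(1) V(1) less(1)] .
  obtain t where t: "0 \<le> t" "t < w {x, y}" "(y, q) \<in> (light_edges G w t)\<^sup>*"
    using bottleneck_lessD [OF conn V(2) pq(2) less(2)] .
  obtain xs where xs: "distinct xs" "xs \<noteq> []" "hd xs = p" "last xs = x"
    "path_edges xs \<subseteq> edges G" "\<forall>e\<in>path_edges xs. w e \<le> s"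
    using light_edges_rtrancl_distinct_list [OF s(3)] by metis
  obtain ys where ys: "distinct ys" "ys \<noteq> []" "hd ys = y" "last ys = q"
    "path_edges ys \<subseteq> edges G" "\<forall>e\<in>path_edges ys. w e \<le> t"
    using light_edges_rtrancl_distinct_list [OF t(3)] by metis
  have "set xs \<inter> set ys = {}"
  proof (rule ccontr)
    assume "set xs \<inter> set ys \<noteq> {}"
    then obtain z where z: "z \<in> set xs" "z \<in> set ys"
      by blast
    let ?R = "(light_edges G w (max s t))\<^sup>*"
    have "(p, z) \<in> (light_edges G w s)\<^sup>*" "(y, z) \<in> (light_edges G w t)\<^sup>*"
      using path_edges_light_edges [OF xs(2,5,6)] path_edges_light_edges [OF ys(2,5,6)] z
        xs(3) ys(3) by auto
    then have "(p, z) \<in> ?R" "(y, z) \<in> ?R" "(p, x) \<in> ?R"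
      using s(3) by (meson light_edges_rtrancl_mono max.cobounded1 max.cobounded2)+
    then have "(x, y) \<in> ?R"
      by (meson light_edges_rtrancl_sym rtrancl_trans)
    then have "bottleneck G w x y \<le> max s t"
      using s by (intro bottleneck_le) auto
    then show False
      using bottleneck_eq_weight [OF G conn d xy] s t by simp
  qed
  then have dist: "distinct (xs @ ys)"
    using xs ys by simp
  have E: "path_edges (xs @ ys) = path_edges xs \<union> path_edges ys \<union> {{x, y}}"
    using path_edges_append [OF xs(2) ys(2)] xs ys by simp
  have "2 \<le> length (xs @ ys)"
    using xs(2) ys(2) by (cases xs; cases ys) auto
  then obtain P where P: "P \<in> paths_between G p q" "edges P = path_edges (xs @ ys)"
    using paths_between_listI [OF gr dist] E xs ys xy pq(1)
    by (metis Un_subset_iff empty_subsetI hd_append2 insert_subset last_append)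
  have max: "w {x, y} \<le> Max (w ` edges P)"
    using P(2) E by (intro Max_ge) auto
  have "e = {x, y}" if "e \<in> edges P" "w e = Max (w ` edges P)" for e
    using that P(2) E max xs(6) ys(6) s t by fastforce
  then show False
    using TM [OF P(1)] by metis
qed

section \<open>Uniqueness of the extension\<close>

lemma restrict_extending_pseudoultrametricI:
  assumes "\<And>x y. x \<in> verts G \<Longrightarrow> y \<in> verts G \<Longrightarrow> 0 \<le> f x y"
    and "\<And>x y. x \<in> verts G \<Longrightarrow> y \<in> verts G \<Longrightarrow> f x y = f y x"
    and "\<And>x. x \<in> verts G \<Longrightarrow> f x x = 0"
    and "\<And>x y z. x \<in> verts G \<Longrightarrow> y \<in> verts G \<Longrightarrow> z \<in> verts G \<Longrightarrow>
      f x z \<le> max (f x y) (f y z)"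
    and "\<And>x y. {x, y} \<in> edges G \<Longrightarrow> f x y = w {x, y}"
  shows "(\<lambda>(x, y)\<in>verts G \<times> verts G. f x y) \<in> extending_pseudoultrametrics G w"
    (is "?d \<in> _")
proof -
  have "?d \<in> (verts G \<times> verts G) \<rightarrow>\<^sub>E {0..}"
    using assms(1) by auto
  moreover have "\<forall>x\<in>verts G. \<forall>y\<in>verts G. ?d (x, y) = ?d (y, x)"
    using assms(2) by simp
  moreover have "\<forall>x\<in>verts G. ?d (x, x) = 0"
    using assms(3) by simp
  moreover have "\<forall>x\<in>verts G. \<forall>y\<in>verts G. \<forall>z\<in>verts G.
      ?d (x, y) \<le> max (?d (x, z)) (?d (z, y))"
    using assms(4) by simp
  moreover have "extends_weight G w ?d"
    using assms(5) by (simp add: extends_weight_def)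
  ultimately show ?thesis
    unfolding extending_pseudoultrametrics_def pseudoultrametric_on_def by blast
qed

text \<open>The two extensions are the bottleneck distance and the same distance with the points of a
  pair in \<open>TM\<close> that is not well chained glued together.\<close>

lemma two_extensions_if_TM_not_subset_WCh:
  assumes G: "weighted_graph G w" and conn: "connected_graph G"
    and d: "d \<in> extending_pseudoultrametrics G w" and "\<not> TM G w \<subseteq> WCh G w"
  obtains d1 d2 where "d1 \<in> extending_pseudoultrametrics G w"
    "d2 \<in> extending_pseudoultrametrics G w" "d1 \<noteq> d2"
proof -
  obtain f where f: "f \<in> TM G w" "f \<notin> WCh G w"
    using assms(4) by blast
  then obtain p q where f_eq: "f = {p, q}"
    and pq: "p \<in> verts G" "q \<in> verts G" "p \<noteq> q" "{p, q} \<notin> edges G"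
    and TM: "\<forall>P\<in>paths_between G p q. \<exists>e1\<in>edges P. \<exists>e2\<in>edges P. e1 \<noteq> e2 \<and>
        w e1 = Max (w ` edges P) \<and> w e2 = Max (w ` edges P)"
    unfolding TM_def by (elim CollectE exE conjE)
  have "\<not> (\<forall>\<epsilon>>0. \<exists>P\<in>paths_between G p q. \<forall>e\<in>edges P. w e \<le> \<epsilon>)" (is "\<not> ?chained")
  proof
    assume ?chained
    then have "f \<in> WCh G w"
      unfolding WCh_def by (intro CollectI exI [of _ p] exI [of _ q] conjI f_eq pq)
    with f(2) show False
      by blast
  qed
  then obtain \<epsilon> where \<epsilon>: "0 < \<epsilon>" "\<And>P. P \<in> paths_between G p q \<Longrightarrow> \<exists>e\<in>edges P. \<epsilon> < w e"
    by (meson not_le)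
  have gr: "is_graph G"
    using G unfolding weighted_graph_def by simp
  let ?b = "bottleneck G w" and ?g = "glue (bottleneck G w) p q"
  have nonneg: "0 \<le> ?b x y" if "x \<in> verts G" "y \<in> verts G" for x y
    using that by (intro bottleneck_ge conn)
  have b: "(\<lambda>(x, y)\<in>verts G \<times> verts G. ?b x y) \<in> extending_pseudoultrametrics G w"
    by (rule restrict_extending_pseudoultrametricI)
      (simp_all add: nonneg conn bottleneck_ultra bottleneck_eq_weight [OF G conn d]
        bottleneck_sym)
  have glue_edge: "?g x y = w {x, y}" if xy: "{x, y} \<in> edges G" for x y
  proof -
    have "w {x, y} \<le> max (?b p x) (?b y q)" "w {y, x} \<le> max (?b p y) (?b x q)"
      using xy
      by (intro weight_le_shortcut [OF G conn d pq(1,2) bspec [OF TM]];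
          simp add: insert_commute)+
    then show ?thesis
      using bottleneck_eq_weight [OF G conn d xy] bottleneck_sym [of G w p x]
        bottleneck_sym [of G w y q]
      unfolding glue_def by (simp add: insert_commute)
  qed
  have g: "(\<lambda>(x, y)\<in>verts G \<times> verts G. ?g x y) \<in> extending_pseudoultrametrics G w"
  proof (rule restrict_extending_pseudoultrametricI)
    fix x y
    show "?g x y = ?g y x"
      using bottleneck_sym [of G w x] bottleneck_sym [of G w _ y]
      unfolding glue_def by (simp add: max.commute min.commute)
    assume "x \<in> verts G" "y \<in> verts G"
    then show "0 \<le> ?g x y"
      using nonneg pq unfolding glue_def by (simp add: le_max_iff_disj)
  next
    fix x assume "x \<in> verts G"
    then show "?g x x = 0"
      using nonneg pq conn unfolding glue_def by (simp add: le_max_iff_disj min_def)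
  next
    fix x y z assume "x \<in> verts G" "y \<in> verts G" "z \<in> verts G"
    then show "?g x z \<le> max (?g x y) (?g y z)"
      using pq by (intro glue_ultra [where X = "verts G"] bottleneck_sym bottleneck_ultra conn)
  qed (fact glue_edge)
  have "?g p q = 0"
    using conn pq nonneg [of p q] unfolding glue_def by simp
  moreover have "0 < ?b p q"
    using bottleneck_pos_if_not_well_chained [OF gr conn pq(1-3) \<epsilon>] .
  ultimately have "(\<lambda>(x, y)\<in>verts G \<times> verts G. ?b x y) (p, q) \<noteq>
      (\<lambda>(x, y)\<in>verts G \<times> verts G. ?g x y) (p, q)"
    using pq by simp
  then have "(\<lambda>(x, y)\<in>verts G \<times> verts G. ?b x y) \<noteq> (\<lambda>(x, y)\<in>verts G \<times> verts G. ?g x y)"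
    by (rule contrapos_nn) (simp only:)
  then show ?thesis
    by (rule that [OF b g])
qed

theorem theorem5p7:
  fixes G :: "'a ugraph" and w :: "'a set \<Rightarrow> real"
  assumes "weighted_graph G w"
    and "connected_graph G"
    and "edges G \<noteq> {}"
    and "pseudoultrametrizable G w"
  shows "(\<exists>!d. d \<in> extending_pseudoultrametrics G w) \<longleftrightarrow> TM G w \<subseteq> WCh G w"
proof -
  have gr: "is_graph G"
    using assms(1) unfolding weighted_graph_def by simp
  obtain d where d: "d \<in> extending_pseudoultrametrics G w"
    using assms(4) unfolding pseudoultrametrizable_def extending_pseudoultrametrics_def by blast
  show ?thesis
  proof
    assume "\<exists>!d. d \<in> extending_pseudoultrametrics G w"
    then show "TM G w \<subseteq> WCh G w"
      using two_extensions_if_TM_not_subset_WCh [OF assms(1,2) d] by metis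
  next
    assume "TM G w \<subseteq> WCh G w"
    then show "\<exists>!d. d \<in> extending_pseudoultrametrics G w"
      using d extension_unique_if_TM_subset_WCh [OF gr] by blast
  qed
qed

end
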